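(* A random variable $T$ (with values in $[0,\infty]$) is a stopping time with respect to $(\mathcal F_t)_{t\in[0,\infty)}$ if and only if the following property holds: if the set $\{T<\gamma\}$ is non-empty, then there exists an $\mathcal H$-measurable stopping time $S$ such that $$\{T<\gamma\}=\{T=S<\gamma\}=\{S<\gamma\}.$$
   Context: $(\Omega,\mathcal F,\mathsf P)$ is a probability space, $\mathcal H\subset\mathcal F$ is a sub-$\sigma$-algebra, and $\gamma$ is a random variable with values in $[0,\infty]$ such that $\mathsf P(\gamma>0)=1$. For $t\in[0,\infty)$, $\mathcal F_t$ is the collection of all $A\in\mathcal F$ for which there exists $C\in\mathcal H$ with $A\cap\{t<\gamma\}=C\cap\{t<\gamma\}$; $(\mathcal F_t)_{t\ge 0}$ is a right-continuous filtration. Standing assumption: this filtration contains all $\mathsf P$-null sets of $\mathcal F$ (so it satisfies the usual conditions). A stopping time is a $[0,\infty]$-valued random variable $T$ with $\{T\le t\}\in\mathcal F_t$ for all $t\ge 0$; an $\mathcal H$-measurable stopping time is one that is $\mathcal H$-measurable as a random variable. $\{T=S<\gamma\}$ denotes $\{T=S\}\cap\{S<\gamma\}$. *)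

theory Defs
  imports "HOL-Probability.Probability"
begin

text \<open>
  The index type is \<^typ>\<open>ennreal\<close>, so that the library's \<^const>\<open>stopping_time\<close> applies to times with
  values in \<open>[0,\<infinity>]\<close>. The extra index \<open>\<infinity>\<close> is harmless: \<open>\<infinity> < \<gamma>\<close> never holds, so the
  \<open>\<sigma>\<close>-algebra at \<open>\<infinity>\<close> is all of \<open>sets M\<close>, and lemma \<open>stopping_time_sigma_before_iff\<close>
  below recovers the definition that tests the real times \<open>t \<ge> 0\<close> only. Lemma
  \<open>sets_sigma_before\<close> shows that the generating collection already is a \<open>\<sigma>\<close>-algebra.
\<close>

definition sigma_before :: "'a measure \<Rightarrow> 'a measure \<Rightarrow> ('a \<Rightarrow> ennreal) \<Rightarrow> ennreal \<Rightarrow> 'a measure"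
where
  "sigma_before M H \<gamma> t = sigma (space M)
     {A \<in> sets M. \<exists>C\<in>sets H. A \<inter> {\<omega> \<in> space M. t < \<gamma> \<omega>} = C \<inter> {\<omega> \<in> space M. t < \<gamma> \<omega>}}"

lemma space_sigma_before [simp]: "space (sigma_before M H \<gamma> t) = space M"
  unfolding sigma_before_def using sets.sets_into_space by (intro space_measure_of) blast

lemma sets_sigma_before:
  assumes "subalgebra M H"
  shows "sets (sigma_before M H \<gamma> t) =
    {A \<in> sets M. \<exists>C\<in>sets H. A \<inter> {\<omega> \<in> space M. t < \<gamma> \<omega>} = C \<inter> {\<omega> \<in> space M. t < \<gamma> \<omega>}}"
    (is "_ = ?G")
proof -
  have sp: "space H = space M"
    using assms by (simp add: subalgebra_def)
  have "sigma_algebra (space M) ?G"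
    unfolding sigma_algebra_iff2
  proof (intro conjI ballI allI impI)
    show "?G \<subseteq> Pow (space M)"
      using sets.sets_into_space by blast
    show "{} \<in> ?G"
      by (auto intro!: bexI[of _ "{}"])
  next
    fix A assume "A \<in> ?G"
    then obtain C where A: "A \<in> sets M" and C: "C \<in> sets H"
      and eq: "A \<inter> {\<omega> \<in> space M. t < \<gamma> \<omega>} = C \<inter> {\<omega> \<in> space M. t < \<gamma> \<omega>}"
      by blast
    have "space M - C \<in> sets H"
      using sets.compl_sets[OF C] by (simp add: sp)
    moreover have "(space M - A) \<inter> {\<omega> \<in> space M. t < \<gamma> \<omega>}
        = (space M - C) \<inter> {\<omega> \<in> space M. t < \<gamma> \<omega>}"
      using eq by blast
    ultimately show "space M - A \<in> ?G"
      using A by blast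
  next
    fix A :: "nat \<Rightarrow> 'a set" assume A: "range A \<subseteq> ?G"
    then have AM: "A n \<in> sets M" for n
      by blast
    from A have "\<forall>n. \<exists>C\<in>sets H. A n \<inter> {\<omega> \<in> space M. t < \<gamma> \<omega>} = C \<inter> {\<omega> \<in> space M. t < \<gamma> \<omega>}"
      by blast
    then obtain C where C: "\<And>n. C n \<in> sets H"
      and eq: "\<And>n. A n \<inter> {\<omega> \<in> space M. t < \<gamma> \<omega>} = C n \<inter> {\<omega> \<in> space M. t < \<gamma> \<omega>}"
      unfolding Bex_def choice_iff by blast
    have "(\<Union>n. C n) \<in> sets H"
      using C by blast
    moreover have "(\<Union>n. A n) \<inter> {\<omega> \<in> space M. t < \<gamma> \<omega>} = (\<Union>n. C n) \<inter> {\<omega> \<in> space M. t < \<gamma> \<omega>}"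
      using eq by blast
    moreover have "(\<Union>n. A n) \<in> sets M"
      using AM by blast
    ultimately show "(\<Union>n. A n) \<in> ?G"
      by blast
  qed
  then show ?thesis
    unfolding sigma_before_def by (rule sigma_algebra.sets_measure_of_eq)
qed

lemma filtration_sigma_before:
  assumes "subalgebra M H"
  shows "filtration (space M) (sigma_before M H \<gamma>)"
proof
  fix s t :: ennreal assume st: "s \<le> t"
  have *: "A \<inter> {\<omega> \<in> space M. t < \<gamma> \<omega>} = C \<inter> {\<omega> \<in> space M. t < \<gamma> \<omega>}"
    if "A \<inter> {\<omega> \<in> space M. s < \<gamma> \<omega>} = C \<inter> {\<omega> \<in> space M. s < \<gamma> \<omega>}" for A C
  proof -
    have "{\<omega> \<in> space M. t < \<gamma> \<omega>} \<subseteq> {\<omega> \<in> space M. s < \<gamma> \<omega>}"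
      using st by auto
    with that show ?thesis by blast
  qed
  show "sets (sigma_before M H \<gamma> s) \<le> sets (sigma_before M H \<gamma> t)"
    unfolding sets_sigma_before[OF assms]
  proof (rule Collect_mono, rule impI, elim conjE bexE, intro conjI)
    fix A C
    assume "C \<in> sets H" "A \<inter> {\<omega> \<in> space M. s < \<gamma> \<omega>} = C \<inter> {\<omega> \<in> space M. s < \<gamma> \<omega>}"
    then show "\<exists>C\<in>sets H. A \<inter> {\<omega> \<in> space M. t < \<gamma> \<omega>} = C \<inter> {\<omega> \<in> space M. t < \<gamma> \<omega>}"
      by (intro bexI[of _ C] *)
  qed
qed simp

lemma sigma_before_right_continuous:
  assumes H: "subalgebra M H" and t: "t < \<infinity>"
  shows "sets (sigma_before M H \<gamma> t) = (\<Inter>s\<in>{t<..}. sets (sigma_before M H \<gamma> s))"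
proof (intro equalityI subsetI)
  fix A assume "A \<in> sets (sigma_before M H \<gamma> t)"
  then show "A \<in> (\<Inter>s\<in>{t<..}. sets (sigma_before M H \<gamma> s))"
    using filtration.sets_F_mono[OF filtration_sigma_before[OF H]] by (auto dest: less_imp_le)
next
  fix A assume A: "A \<in> (\<Inter>s\<in>{t<..}. sets (sigma_before M H \<gamma> s))"
  obtain u :: "nat \<Rightarrow> ennreal" where u: "\<And>n. t < u n" "u \<longlonglongrightarrow> t"
    using approx_from_above_dense_linorder[of t \<infinity>] t by blast
  have An: "A \<in> sets (sigma_before M H \<gamma> (u n))" for n
    using A u(1) by blast
  then have AM: "A \<in> sets M"
    by (simp add: sets_sigma_before[OF H])
  have "\<forall>n. \<exists>C\<in>sets H. A \<inter> {\<omega> \<in> space M. u n < \<gamma> \<omega>} = C \<inter> {\<omega> \<in> space M. u n < \<gamma> \<omega>}"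
    using An by (simp add: sets_sigma_before[OF H])
  then obtain C where C: "\<And>n. C n \<in> sets H"
    and eq: "\<And>n. A \<inter> {\<omega> \<in> space M. u n < \<gamma> \<omega>} = C n \<inter> {\<omega> \<in> space M. u n < \<gamma> \<omega>}"
    unfolding Bex_def choice_iff by blast
  define D where "D = (\<Union>m. \<Inter>n\<in>{m..}. C n)"
  have "D \<in> sets H"
    unfolding D_def using C by (intro sets.countable_UN sets.countable_INT'') auto
  moreover have "\<omega> \<in> A \<longleftrightarrow> \<omega> \<in> D" if w: "\<omega> \<in> space M" "t < \<gamma> \<omega>" for \<omega>
  proof -
    obtain N where N: "\<And>n. n \<ge> N \<Longrightarrow> u n < \<gamma> \<omega>"
      using order_tendstoD(2)[OF u(2) w(2)] by (auto simp: eventually_sequentially)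
    have iff: "\<omega> \<in> A \<longleftrightarrow> \<omega> \<in> C n" if "n \<ge> N" for n
      using eq[of n] N[OF that] w(1) by blast
    show ?thesis
    proof
      assume "\<omega> \<in> A"
      then show "\<omega> \<in> D" using iff by (auto simp: D_def)
    next
      assume "\<omega> \<in> D"
      then obtain m where "\<And>n. n \<ge> m \<Longrightarrow> \<omega> \<in> C n" by (auto simp: D_def)
      then have "\<omega> \<in> C (max m N)" by simp
      then show "\<omega> \<in> A" using iff[of "max m N"] by simp
    qed
  qed
  then have "A \<inter> {\<omega> \<in> space M. t < \<gamma> \<omega>} = D \<inter> {\<omega> \<in> space M. t < \<gamma> \<omega>}"
    by (intro set_eqI) (metis (mono_tags, lifting) Int_iff mem_Collect_eq)
  ultimately have "\<exists>C\<in>sets H. A \<inter> {\<omega> \<in> space M. t < \<gamma> \<omega>} = C \<inter> {\<omega> \<in> space M. t < \<gamma> \<omega>}"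
    by (rule bexI[rotated])
  with AM show "A \<in> sets (sigma_before M H \<gamma> t)"
    by (simp add: sets_sigma_before[OF H])
qed

lemma stopping_time_sigma_before_iff:
  assumes H: "subalgebra M H"
  shows "stopping_time (sigma_before M H \<gamma>) T \<longleftrightarrow>
    T \<in> borel_measurable M \<and>
    (\<forall>t::real. 0 \<le> t \<longrightarrow> {\<omega> \<in> space M. T \<omega> \<le> ennreal t} \<in> sets (sigma_before M H \<gamma> (ennreal t)))"
    (is "?L \<longleftrightarrow> ?R")
proof
  assume L: ?L
  have "T \<in> borel_measurable M"
    by (rule measurable_stopping_time[OF L]) (auto simp: sets_sigma_before[OF H])
  moreover have "{\<omega> \<in> space M. T \<omega> \<le> t} \<in> sets (sigma_before M H \<gamma> t)" for t
    using stopping_timeD[OF L, of t] by (simp add: pred_def)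
  ultimately show ?R
    by blast
next
  assume R: ?R
  show ?L
  proof (rule stopping_timeI)
    fix t :: ennreal
    show "Measurable.pred (sigma_before M H \<gamma> t) (\<lambda>\<omega>. T \<omega> \<le> t)"
    proof (cases t)
      case (real r)
      then show ?thesis
        using R by (simp add: pred_def)
    next
      case top
      then show ?thesis
        by simp
    qed
  qed
qed

end

theory Submission
  imports Defs
begin

text \<open>
  Before \<open>\<gamma>\<close> the filtration sees only \<open>H\<close>: on \<open>{t < \<gamma>}\<close>, every event of \<open>F\<^sub>t\<close> is the trace of an
  event of \<open>H\<close>. The matching condition on \<open>T\<close> and \<open>S\<close> says, point by point, that \<open>T\<close> and \<open>S\<close> are
  either both equal to the same time before \<open>\<gamma>\<close>, or both at least \<open>\<gamma>\<close>.

  Suppose that \<open>T\<close> is a stopping time, and for \<open>d\<close> in a countable dense set of times let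
  \<open>C\<^sub>d \<in> H\<close> have the same trace on \<open>{d < \<gamma>}\<close> as \<open>{T \<le> d}\<close>. Put \<open>S \<omega> = inf {d. \<omega> \<in> C\<^sub>d}\<close>. As a
  countable infimum, \<open>S\<close> is measurable for \<open>H\<close>. At a point \<open>\<omega>\<close> the condition \<open>\<omega> \<in> C\<^sub>d\<close> is
  meaningful only for \<open>d < \<gamma> \<omega>\<close>, where it means \<open>T \<omega> \<le> d\<close>; the uncontrolled sets with
  \<open>d \<ge> \<gamma> \<omega>\<close> can only contribute values \<open>\<ge> \<gamma> \<omega>\<close> to the infimum. So \<open>S = T\<close> where \<open>T < \<gamma>\<close>, and
  \<open>S \<ge> \<gamma>\<close> elsewhere (\<open>exists_subalgebra_time_agreeing\<close>).

  Conversely, if \<open>T\<close> and \<open>S\<close> match in this sense, then \<open>{T \<le> t}\<close> and \<open>{S \<le> t}\<close> have the same trace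
  on \<open>{t < \<gamma>}\<close>, because a time that is at most \<open>t\<close> there lies before \<open>\<gamma>\<close>; and
  \<open>{S \<le> t} \<in> H\<close> (\<open>stopping_time_if_agreeing\<close>). If \<open>T\<close> never occurs before \<open>\<gamma>\<close>, the
  constant \<open>S = \<infinity>\<close> matches it.
\<close>

text \<open>
  It suffices to test trace conditions: measurability with respect to the large \<open>\<sigma>\<close>-algebra takes
  care of everything outside \<open>{t < \<gamma>}\<close>.
\<close>

lemma stopping_time_sigma_before_iff_trace:
  assumes H: "subalgebra M H" and T: "T \<in> borel_measurable M"
  shows "stopping_time (sigma_before M H \<gamma>) T \<longleftrightarrow>
    (\<forall>t. \<exists>C\<in>sets H. \<forall>\<omega>\<in>space M. t < \<gamma> \<omega> \<longrightarrow> (T \<omega> \<le> t \<longleftrightarrow> \<omega> \<in> C))"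
proof -
  have "{\<omega> \<in> space M. T \<omega> \<le> t} \<in> sets M" for t
    using T by measurable
  then have "{\<omega> \<in> space M. T \<omega> \<le> t} \<in> sets (sigma_before M H \<gamma> t) \<longleftrightarrow>
      (\<exists>C\<in>sets H. \<forall>\<omega>\<in>space M. t < \<gamma> \<omega> \<longrightarrow> (T \<omega> \<le> t \<longleftrightarrow> \<omega> \<in> C))" for t
    unfolding sets_sigma_before[OF H] by blast
  then have "Measurable.pred (sigma_before M H \<gamma> t) (\<lambda>\<omega>. T \<omega> \<le> t) \<longleftrightarrow>
      (\<exists>C\<in>sets H. \<forall>\<omega>\<in>space M. t < \<gamma> \<omega> \<longrightarrow> (T \<omega> \<le> t \<longleftrightarrow> \<omega> \<in> C))" for t
    by (simp add: pred_def)
  then show ?thesis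
    by (simp add: stopping_time_def)
qed

lemma stopping_time_if_agreeing:
  assumes H: "subalgebra M H" and T: "T \<in> borel_measurable M" and S: "S \<in> borel_measurable H"
    and agree: "\<And>\<omega>. \<omega> \<in> space M \<Longrightarrow> T \<omega> < \<gamma> \<omega> \<or> S \<omega> < \<gamma> \<omega> \<Longrightarrow> T \<omega> = S \<omega>"
  shows "stopping_time (sigma_before M H \<gamma>) T"
  unfolding stopping_time_sigma_before_iff_trace[OF H T]
proof
  fix t
  have "{\<omega> \<in> space H. S \<omega> \<le> t} \<in> sets H"
    using S by measurable
  moreover have "space H = space M"
    using H by (simp add: subalgebra_def)
  moreover have "T \<omega> \<le> t \<longleftrightarrow> S \<omega> \<le> t" if "\<omega> \<in> space M" "t < \<gamma> \<omega>" for \<omega>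
    using agree[OF that(1)] that(2) by (metis le_less_trans)
  ultimately show "\<exists>C\<in>sets H. \<forall>\<omega>\<in>space M. t < \<gamma> \<omega> \<longrightarrow> (T \<omega> \<le> t \<longleftrightarrow> \<omega> \<in> C)"
    by (intro bexI[of _ "{\<omega> \<in> space H. S \<omega> \<le> t}"]) auto
qed

corollary stopping_time_if_subalgebra_measurable:
  assumes "subalgebra M H" and "S \<in> borel_measurable H"
  shows "stopping_time (sigma_before M H \<gamma>) S"
  using assms measurable_from_subalg by (intro stopping_time_if_agreeing[of M H S S]) auto

text \<open>
  The time \<open>S\<close> is reconstructed from the sets \<open>C\<^sub>d\<close> in the way in which a random variable is
  recovered from its sublevel sets; countably many levels are enough, which keeps \<open>S\<close> measurable.
\<close>

lemma exists_subalgebra_time_agreeing: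
  assumes H: "subalgebra M H" and stop: "stopping_time (sigma_before M H \<gamma>) T"
    and T: "T \<in> borel_measurable M"
  obtains S where "S \<in> borel_measurable H"
    and "\<And>\<omega>. \<omega> \<in> space M \<Longrightarrow> T \<omega> < \<gamma> \<omega> \<or> S \<omega> < \<gamma> \<omega> \<Longrightarrow> T \<omega> = S \<omega>"
proof -
  obtain C where C: "\<And>t. C t \<in> sets H"
    and trace: "\<And>t \<omega>. \<omega> \<in> space M \<Longrightarrow> t < \<gamma> \<omega> \<Longrightarrow> T \<omega> \<le> t \<longleftrightarrow> \<omega> \<in> C t"
    using stop unfolding stopping_time_sigma_before_iff_trace[OF H T] Bex_def choice_iff by blast
  obtain D :: "ennreal set" where D: "countable D"
    and dense: "\<And>x y. x < y \<Longrightarrow> \<exists>d\<in>D. x < d \<and> d < y"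
    using countable_separating_set_dense_linorder by blast
  define S where "S \<omega> = (INF d\<in>D. if \<omega> \<in> C d then d else \<infinity>)" for \<omega>
  show thesis
  proof
    show "S \<in> borel_measurable H"
      unfolding S_def using C by (intro borel_measurable_INF D measurable_If_set) auto
  next
    fix \<omega> assume w: "\<omega> \<in> space M" and before: "T \<omega> < \<gamma> \<omega> \<or> S \<omega> < \<gamma> \<omega>"
    have lower: "min (T \<omega>) (\<gamma> \<omega>) \<le> S \<omega>"
      unfolding S_def
    proof (rule INF_greatest)
      fix d
      show "min (T \<omega>) (\<gamma> \<omega>) \<le> (if \<omega> \<in> C d then d else \<infinity>)"
        using trace[OF w, of d] by (cases "d < \<gamma> \<omega>") (auto simp: min_le_iff_disj)
    qed
    have upper: "S \<omega> \<le> T \<omega>" if "T \<omega> < \<gamma> \<omega>"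
    proof (rule ccontr)
      assume "\<not> S \<omega> \<le> T \<omega>"
      with that have "T \<omega> < min (S \<omega>) (\<gamma> \<omega>)"
        by simp
      then obtain d where d: "d \<in> D" "T \<omega> < d" "d < S \<omega>" "d < \<gamma> \<omega>"
        using dense by (metis min_less_iff_conj)
      then have "\<omega> \<in> C d"
        using trace[OF w d(4)] less_imp_le[OF d(2)] by blast
      with d(1) have "S \<omega> \<le> d"
        unfolding S_def by (intro INF_lower2[of d]) auto
      with d(3) show False
        by simp
    qed
    have "T \<omega> < \<gamma> \<omega>" "T \<omega> \<le> S \<omega>"
      using before lower upper by (auto simp: min_le_iff_disj)
    with upper show "T \<omega> = S \<omega>"
      by (simp add: antisym)
  qed
qed

theorem proposition2p3:
  fixes M H :: "'a measure" and \<gamma> T :: "'a \<Rightarrow> ennreal"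
  assumes "prob_space M"
    and "subalgebra M H"
    and "\<gamma> \<in> borel_measurable M"
    and "measure M {\<omega> \<in> space M. 0 < \<gamma> \<omega>} = 1"
    and "\<And>t. t < \<infinity> \<Longrightarrow> null_sets M \<subseteq> sets (sigma_before M H \<gamma> t)"
    and "T \<in> borel_measurable M"
  shows "stopping_time (sigma_before M H \<gamma>) T \<longleftrightarrow>
    ({\<omega> \<in> space M. T \<omega> < \<gamma> \<omega>} \<noteq> {} \<longrightarrow>
      (\<exists>S. stopping_time (sigma_before M H \<gamma>) S \<and> S \<in> borel_measurable H \<and>
        {\<omega> \<in> space M. T \<omega> < \<gamma> \<omega>} = {\<omega> \<in> space M. T \<omega> = S \<omega>} \<inter> {\<omega> \<in> space M. S \<omega> < \<gamma> \<omega>} \<and>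
        {\<omega> \<in> space M. T \<omega> = S \<omega>} \<inter> {\<omega> \<in> space M. S \<omega> < \<gamma> \<omega>} = {\<omega> \<in> space M. S \<omega> < \<gamma> \<omega>}))"
    (is "?L \<longleftrightarrow> (?N \<longrightarrow> ?R)")
proof
  assume ?L
  then obtain S where S: "S \<in> borel_measurable H"
    and agree: "\<And>\<omega>. \<omega> \<in> space M \<Longrightarrow> T \<omega> < \<gamma> \<omega> \<or> S \<omega> < \<gamma> \<omega> \<Longrightarrow> T \<omega> = S \<omega>"
    using exists_subalgebra_time_agreeing assms(2,6) by blast
  have "T \<omega> < \<gamma> \<omega> \<longleftrightarrow> T \<omega> = S \<omega> \<and> S \<omega> < \<gamma> \<omega>" "T \<omega> = S \<omega> \<and> S \<omega> < \<gamma> \<omega> \<longleftrightarrow> S \<omega> < \<gamma> \<omega>"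
    if "\<omega> \<in> space M" for \<omega>
    using agree[OF that] by auto
  then have "{\<omega> \<in> space M. T \<omega> < \<gamma> \<omega>} = {\<omega> \<in> space M. T \<omega> = S \<omega>} \<inter> {\<omega> \<in> space M. S \<omega> < \<gamma> \<omega>}"
    and "{\<omega> \<in> space M. T \<omega> = S \<omega>} \<inter> {\<omega> \<in> space M. S \<omega> < \<gamma> \<omega>} = {\<omega> \<in> space M. S \<omega> < \<gamma> \<omega>}"
    by blast+
  with S show "?N \<longrightarrow> ?R"
    using stopping_time_if_subalgebra_measurable[OF assms(2)] by blast
next
  assume R: "?N \<longrightarrow> ?R"
  show ?L
  proof (cases ?N)
    case True
    with R obtain S where S: "S \<in> borel_measurable H"
      and "{\<omega> \<in> space M. T \<omega> < \<gamma> \<omega>} = {\<omega> \<in> space M. T \<omega> = S \<omega>} \<inter> {\<omega> \<in> space M. S \<omega> < \<gamma> \<omega>}"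
      and "{\<omega> \<in> space M. T \<omega> = S \<omega>} \<inter> {\<omega> \<in> space M. S \<omega> < \<gamma> \<omega>} = {\<omega> \<in> space M. S \<omega> < \<gamma> \<omega>}"
      by blast
    then have "T \<omega> = S \<omega>" if "\<omega> \<in> space M" "T \<omega> < \<gamma> \<omega> \<or> S \<omega> < \<gamma> \<omega>" for \<omega>
      using that by blast
    with assms(2,6) S show ?thesis
      by (rule stopping_time_if_agreeing)
  next
    case False
    then show ?thesis
      using assms(2,6) by (intro stopping_time_if_agreeing[of M H T "\<lambda>_. \<infinity>"]) auto
  qed
qed

end
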